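(* Let $A=[a_1\ \cdots\ a_n]\in\mathbb{R}^{d\times n}$ with $\|a_i\|=1$ for $i=1,\dots,n$, and assume there exists $w\in\mathbb{R}^d$ with $A^Tw>\mathbf{0}$. Let $w_t=A\alpha_t$, $t=0,1,\dots$, be a sequence of Normalized Perceptron iterates, let $$\rho_t=\inf_{p\in\triangle}\Big(\frac{w_t}{\|w_t\|}\Big)^TAp$$ be the margin of $w_t$, and let $w_*=\arg\sup_{\|w\|=1}\inf_{p\in\triangle}w^TAp$ be the optimal point, which achieves the optimal margin $\rho_A^+=\sup_{\|w\|=1}\inf_{p\in\triangle}w^TAp$. Then for every $t\ge 1$, $$\rho_A^+-\rho_t\le\Big\|\frac{w_t}{\|w_t\|}-w_*\Big\|\le\frac{4}{\rho_A^+\sqrt{t}}.$$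
   Context: $\triangle=\{p\in\mathbb{R}^n: p\ge\mathbf{0},\ \|p\|_1=1\}$ is the probability simplex; $\|\cdot\|$ is the Euclidean norm; $A^Tw>\mathbf{0}$ means every component is strictly positive. $\mathrm{lin}(A)$ is the linear span of the columns of $A$; the affine-margin is $\rho_A:=\sup\{\inf_{p\in\triangle}w^TAp : w\in\mathrm{lin}(A),\ \|w\|=1\}$ and $\rho_A^+:=\max\{0,\rho_A\}$; when $A^Tw>\mathbf{0}$ is feasible, $\rho_A^+$ equals the margin $\sup_{w\in\mathbb{R}^d,\|w\|=1}\inf_{p\in\triangle}w^TAp>0$. Normalized Perceptron (NP): start with $w_0=a_{i_0}$ for an arbitrary index $i_0$; for $t=1,2,\dots$ choose an index $i_t\in\arg\min_{i}\{w_{t-1}^Ta_i\}$ (ties broken arbitrarily) and set $w_t=(1-\tfrac1t)w_{t-1}+\tfrac1t a_{i_t}$. The corresponding coefficient vectors are $\alpha_0=e_{i_0}$, $\alpha_t=(1-\tfrac1t)\alpha_{t-1}+\tfrac1t e_{i_t}$ (with $e_i$ the standard basis vectors of $\mathbb{R}^n$), so $\alpha_t\in\triangle$ and $w_t=A\alpha_t$. *)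

theory Defs
  imports "HOL-Analysis.Analysis"
begin

text \<open>A matrix with \<open>d\<close> rows and \<open>n\<close> columns is \<open>A :: real^'n^'d\<close>; the vector \<open>a\<^sub>i\<close> is
  \<open>column i A\<close>, and \<open>w\<^sup>T A p\<close> is written \<open>w \<bullet> (A *v p)\<close>.\<close>

definition l1_norm :: "real^'n \<Rightarrow> real" where
  "l1_norm p = (\<Sum>i\<in>UNIV. \<bar>p $ i\<bar>)"

definition prob_simplex :: "(real^'n) set" where
  "prob_simplex = {p. (\<forall>i. 0 \<le> p $ i) \<and> l1_norm p = 1}"

definition margin_of :: "real^'n^'d \<Rightarrow> real^'d \<Rightarrow> real" where
  "margin_of A w = (INF p\<in>prob_simplex. w \<bullet> (A *v p))"

definition affine_margin :: "real^'n^'d \<Rightarrow> real" where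
  "affine_margin A = (SUP w\<in>{w \<in> span (columns A). norm w = 1}. margin_of A w)"

definition affine_margin_plus :: "real^'n^'d \<Rightarrow> real" where
  "affine_margin_plus A = max 0 (affine_margin A)"

definition optimal_point :: "real^'n^'d \<Rightarrow> real^'d \<Rightarrow> bool" where
  "optimal_point A w \<longleftrightarrow> is_arg_max (margin_of A) (\<lambda>v. norm v = 1) w"

text \<open>\<open>idx t\<close> is the index chosen in step \<open>t\<close>. Using a relation rather than a function of \<open>t\<close>
  leaves the initial index and the tie-breaking arbitrary.\<close>

definition normalized_perceptron ::
  "real^'n^'d \<Rightarrow> (nat \<Rightarrow> 'n) \<Rightarrow> (nat \<Rightarrow> real^'n) \<Rightarrow> (nat \<Rightarrow> real^'d) \<Rightarrow> bool" where
  "normalized_perceptron A idx \<alpha> w \<longleftrightarrow>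
     w 0 = column (idx 0) A \<and> \<alpha> 0 = axis (idx 0) 1 \<and>
     (\<forall>t\<ge>1.
        is_arg_min (\<lambda>i. w (t - 1) \<bullet> column i A) (\<lambda>_. True) (idx t) \<and>
        w t = (1 - 1 / real t) *\<^sub>R w (t - 1) + (1 / real t) *\<^sub>R column (idx t) A \<and>
        \<alpha> t = (1 - 1 / real t) *\<^sub>R \<alpha> (t - 1) + (1 / real t) *\<^sub>R axis (idx t) 1)"

lemma normalized_perceptron_eq:
  assumes "normalized_perceptron A idx \<alpha> w"
  shows "w t = A *v \<alpha> t"
proof (induction t)
  case 0
  then show ?case
    using assms by (simp add: normalized_perceptron_def matrix_vector_mult_basis)
next
  case (Suc t)
  have "w (Suc t) = (1 - 1 / real (Suc t)) *\<^sub>R w t + (1 / real (Suc t)) *\<^sub>R column (idx (Suc t)) A"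
    and "\<alpha> (Suc t) = (1 - 1 / real (Suc t)) *\<^sub>R \<alpha> t + (1 / real (Suc t)) *\<^sub>R axis (idx (Suc t)) 1"
    using assms unfolding normalized_perceptron_def by (metis diff_Suc_1 le_add1 plus_1_eq_Suc)+
  then show ?case
    using Suc by (simp only: matrix_vector_right_distrib matrix_vector_mult_scaleR
        matrix_vector_mult_basis)
qed

lemma normalized_perceptron_simplex:
  assumes "normalized_perceptron A idx \<alpha> w"
  shows "\<alpha> t \<in> prob_simplex"
proof -
  have *: "p \<in> prob_simplex \<longleftrightarrow> (\<forall>i. 0 \<le> p $ i) \<and> (\<Sum>i\<in>UNIV. p $ i) = 1" for p :: "real^'a"
    by (auto simp: prob_simplex_def l1_norm_def)
  have ax: "axis i 1 \<in> prob_simplex" for i :: 'a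
    by (simp add: * axis_def)
  show ?thesis
  proof (induction t)
    case 0
    then show ?case
      using assms ax by (simp add: normalized_perceptron_def)
  next
    case (Suc t)
    have "\<alpha> (Suc t) = (1 - 1 / real (Suc t)) *\<^sub>R \<alpha> t + (1 / real (Suc t)) *\<^sub>R axis (idx (Suc t)) 1"
      using assms unfolding normalized_perceptron_def by (metis diff_Suc_1 le_add1 plus_1_eq_Suc)
    moreover have "u *\<^sub>R p + v *\<^sub>R q \<in> prob_simplex"
      if "p \<in> prob_simplex" "q \<in> prob_simplex" "u \<ge> 0" "v \<ge> 0" "u + v = 1" for u v and p q :: "real^'a"
      using that by (simp add: * sum.distrib flip: sum_distrib_left)
    ultimately show ?case
      using Suc ax by (simp add: field_simps)
  qed
qed

end

theory Submission imports Defs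
begin

text \<open>Let \<open>z\<close> be the point of least norm in the convex hull \<open>A \<triangle>\<close> of the columns.
  Feasibility gives \<open>z \<noteq> 0\<close>, and the variational inequality \<open>z \<bullet> (x - z) \<ge> 0\<close> on the hull
  shows that \<open>z / \<parallel>z\<parallel>\<close> is the unique optimal direction, with margin \<open>\<parallel>z\<parallel>\<close>.
  The choice of \<open>i\<^sub>t\<close> gives \<open>w\<^sub>t\<^sub>-\<^sub>1 \<bullet> (a - z) \<le> 0\<close> for the chosen column \<open>a\<close>; hence the cross term
  in the expansion of \<open>\<parallel>t (w\<^sub>t - z)\<parallel>\<^sup>2\<close> is nonpositive, so that \<open>\<parallel>w\<^sub>t - z\<parallel> \<le> 1 / sqrt t\<close>.
  Normalizing both vectors costs a factor \<open>2 / \<parallel>z\<parallel>\<close>.\<close>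

lemma prob_simplex_iff: "p \<in> prob_simplex \<longleftrightarrow> (\<forall>i. 0 \<le> p $ i) \<and> (\<Sum>i\<in>UNIV. p $ i) = 1"
  by (auto simp: prob_simplex_def l1_norm_def)

lemma axis_in_prob_simplex: "axis i 1 \<in> prob_simplex"
  by (simp add: prob_simplex_iff axis_def)

lemma convex_prob_simplex: "convex prob_simplex"
  unfolding convex_def by (simp add: prob_simplex_iff sum.distrib flip: sum_distrib_left)

text \<open>Compactness serves twice: it makes the hull of the columns closed, so that a point of
  least norm exists, and it bounds the infimum in \<open>margin_of\<close> from below, as
  \<open>INF\<close> over the reals requires.\<close>

lemma compact_prob_simplex: "compact (prob_simplex :: (real^'n) set)"
proof -
  have "norm p \<le> 1" if "p \<in> prob_simplex" for p :: "real^'n"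
    using that norm_le_l1_cart[of p] by (simp add: prob_simplex_iff)
  moreover have "prob_simplex = (\<Inter>i. {p::real^'n. 0 \<le> p $ i}) \<inter> {p. (\<Sum>i\<in>UNIV. p $ i) = 1}"
    by (auto simp: prob_simplex_iff)
  moreover have "closed \<dots>"
    by (intro closed_Int closed_INT closed_Collect_le closed_Collect_eq ballI continuous_intros)
  ultimately show ?thesis
    by (auto simp: compact_eq_bounded_closed bounded_iff)
qed

lemma inner_matrix_vector_mult:
  fixes A :: "real^'n^'d"
  shows "v \<bullet> (A *v p) = (\<Sum>i\<in>UNIV. p $ i * (v \<bullet> column i A))"
  by (simp add: matrix_mult_sum inner_sum_right scalar_mult_eq_scaleR)

lemma inner_column_le_inner_simplex:
  fixes A :: "real^'n^'d"
  assumes "p \<in> prob_simplex" and "\<And>j. v \<bullet> column i A \<le> v \<bullet> column j A"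
  shows "v \<bullet> column i A \<le> v \<bullet> (A *v p)"
proof -
  have "v \<bullet> column i A = (\<Sum>j\<in>UNIV. p $ j * (v \<bullet> column i A))"
    using assms(1) by (simp add: prob_simplex_iff flip: sum_distrib_right)
  also have "\<dots> \<le> v \<bullet> (A *v p)"
    unfolding inner_matrix_vector_mult
    using assms by (intro sum_mono mult_left_mono) (auto simp: prob_simplex_iff)
  finally show ?thesis .
qed

lemma norm_matrix_simplex_le:
  fixes A :: "real^'n^'d"
  assumes "\<And>i. norm (column i A) \<le> 1" and "p \<in> prob_simplex"
  shows "norm (A *v p) \<le> 1"
proof -
  have "norm (A *v p) \<le> (\<Sum>i\<in>UNIV. norm (p $ i *\<^sub>R column i A))"
    unfolding matrix_mult_sum scalar_mult_eq_scaleR by (rule norm_sum)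
  also have "\<dots> \<le> (\<Sum>i\<in>UNIV. p $ i)"
    using assms by (intro sum_mono) (auto simp: prob_simplex_iff mult_left_le)
  also have "\<dots> = 1"
    using assms(2) by (simp add: prob_simplex_iff)
  finally show ?thesis .
qed

text \<open>Take a preimage of the point of the hull closest to the origin. The inequality is the
  obtuse-angle criterion \<open>closest_point_dot\<close> for that projection.\<close>

lemma min_norm_simplex_image:
  fixes A :: "real^'n^'d"
  obtains p where "p \<in> prob_simplex"
    and "\<And>q. q \<in> prob_simplex \<Longrightarrow> (norm (A *v p))\<^sup>2 \<le> (A *v p) \<bullet> (A *v q)"
proof -
  let ?K = "(\<lambda>p. A *v p) ` prob_simplex"
  have lin: "linear (\<lambda>p. A *v p)"
    by (rule matrix_vector_mul_linear)
  have K: "convex ?K" "closed ?K" "?K \<noteq> {}"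
    using convex_linear_image[OF lin convex_prob_simplex]
      compact_continuous_image[OF linear_continuous_on[OF lin[unfolded linear_conv_bounded_linear]]
        compact_prob_simplex]
      axis_in_prob_simplex by (auto intro: compact_imp_closed)
  obtain p where p: "p \<in> prob_simplex" "closest_point ?K 0 = A *v p"
    using closest_point_in_set[OF K(2,3), of 0] by auto
  have "(norm (A *v p))\<^sup>2 \<le> (A *v p) \<bullet> (A *v q)" if "q \<in> prob_simplex" for q
    using closest_point_dot[OF K(1,2), of "A *v q" 0] that p(2)
    by (simp add: inner_diff_right power2_norm_eq_inner)
  with p(1) show ?thesis
    by (rule that)
qed

lemma margin_of_le:
  fixes A :: "real^'n^'d"
  assumes "p \<in> prob_simplex"
  shows "margin_of A v \<le> v \<bullet> (A *v p)"
proof -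
  have "compact ((\<lambda>p. v \<bullet> (A *v p)) ` prob_simplex)"
    by (intro compact_continuous_image compact_prob_simplex continuous_intros
        linear_continuous_on matrix_vector_mul_bounded_linear)
  then have "bdd_below ((\<lambda>p. v \<bullet> (A *v p)) ` prob_simplex)"
    by (simp add: compact_imp_bounded bounded_imp_bdd_below)
  then show ?thesis
    unfolding margin_of_def using assms by (rule cINF_lower)
qed

lemma margin_of_greatest:
  fixes A :: "real^'n^'d"
  assumes "\<And>p. p \<in> prob_simplex \<Longrightarrow> c \<le> v \<bullet> (A *v p)"
  shows "c \<le> margin_of A v"
  unfolding margin_of_def using assms axis_in_prob_simplex by (intro cINF_greatest) auto

text \<open>The margin is an infimum of linear functions v \<bullet> (A p) whose coefficient vectors
  A p have norm at most 1. With u the optimal direction this becomes the left-hand inequality of the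
  theorem.\<close>

lemma margin_of_lipschitz:
  fixes A :: "real^'n^'d"
  assumes "\<And>i. norm (column i A) \<le> 1"
  shows "margin_of A u - margin_of A v \<le> norm (v - u)"
proof -
  have "margin_of A u - norm (v - u) \<le> margin_of A v"
  proof (rule margin_of_greatest)
    fix p :: "real^'n" assume p: "p \<in> prob_simplex"
    have "(u - v) \<bullet> (A *v p) \<le> norm (u - v) * norm (A *v p)"
      by (rule norm_cauchy_schwarz)
    also have "\<dots> \<le> norm (v - u)"
      using norm_matrix_simplex_le[OF assms p] by (simp add: norm_minus_commute mult_left_le)
    finally show "margin_of A u - norm (v - u) \<le> v \<bullet> (A *v p)"
      using margin_of_le[OF p, of A u] by (simp add: inner_diff_left)
  qed
  then show ?thesis by simp
qed

lemma norm_diff_sgn_le: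
  fixes x z :: "'a::real_normed_vector"
  assumes "z \<noteq> 0"
  shows "norm (sgn x - sgn z) \<le> 2 * norm (x - z) / norm z"
proof (cases "x = 0")
  \<comment> \<open>Here \<open>sgn x = 0\<close>, so the claim reads 1 \<le> 2. Covering this case
    means that iterates need not be shown nonzero.\<close>
  case True
  then show ?thesis using assms by (simp add: norm_sgn)
next
  case False
  \<comment> \<open>Origin of the factor 2: one term corrects the length, the other is
    \<open>x - z\<close>, and each has norm at most \<open>norm (x - z)\<close>.\<close>
  have "norm z *\<^sub>R (sgn x - sgn z) = (norm z - norm x) *\<^sub>R sgn x + (x - z)"
    using assms False by (simp add: sgn_div_norm algebra_simps)
  then have "norm (norm z *\<^sub>R (sgn x - sgn z)) \<le> \<bar>norm z - norm x\<bar> + norm (x - z)"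
    using norm_triangle_ineq[of "(norm z - norm x) *\<^sub>R sgn x" "x - z"] False
    by (simp add: norm_sgn)
  also have "\<dots> \<le> 2 * norm (x - z)"
    using norm_triangle_ineq3[of z x] by (simp add: norm_minus_commute)
  finally show ?thesis
    using assms by (simp add: pos_le_divide_eq mult.commute)
qed

text \<open>The third assumption forces equality in Cauchy-Schwarz, so v and z are parallel with the
  same orientation. This yields uniqueness of the optimal point.\<close>

lemma unit_vector_eq_sgn:
  fixes v z :: "'a::real_inner"
  assumes "norm v = 1" "z \<noteq> 0" "norm z \<le> v \<bullet> z"
  shows "v = sgn z"
proof -
  have "norm v * norm z = v \<bullet> z"
    using assms norm_cauchy_schwarz[of v z] by simp
  then have "norm v *\<^sub>R z = norm z *\<^sub>R v"
    by (metis norm_cauchy_schwarz_eq)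
  then have "z /\<^sub>R norm z = (norm z *\<^sub>R v) /\<^sub>R norm z"
    using assms(1) by simp
  then show ?thesis
    using assms(2) by (simp add: sgn_div_norm)
qed

text \<open>Multiplying by s turns the averaging step into the addition of a single column, so the
  squared scaled distance to the least-norm point grows by at most 1 per step.\<close>

lemma normalized_perceptron_dist:
  fixes A :: "real^'n^'d"
  assumes col: "\<And>i. norm (column i A) \<le> 1"
    and np: "normalized_perceptron A idx \<alpha> w"
    and p: "p \<in> prob_simplex"
    and min: "\<And>q. q \<in> prob_simplex \<Longrightarrow> (norm (A *v p))\<^sup>2 \<le> (A *v p) \<bullet> (A *v q)"
    and "t \<ge> 1"
  shows "norm (w t - A *v p) \<le> 1 / sqrt (real t)"
proof -
  define z where "z = A *v p"
  have sq: "(norm (real s *\<^sub>R (w s - z)))\<^sup>2 \<le> real s" for s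
  proof (induction s)
    \<comment> \<open>The factor \<open>real 0\<close> erases the initial distance, whatever the
      starting index.\<close>
    case 0
    then show ?case by simp
  next
    case (Suc s)
    define a where "a = column (idx (Suc s)) A"
    have step: "is_arg_min (\<lambda>i. w s \<bullet> column i A) (\<lambda>_. True) (idx (Suc s))"
      "w (Suc s) = (1 - 1 / real (Suc s)) *\<^sub>R w s + (1 / real (Suc s)) *\<^sub>R a"
      using np unfolding normalized_perceptron_def a_def by (metis diff_Suc_1 le_add1 plus_1_eq_Suc)+
    have "w s \<bullet> a \<le> w s \<bullet> z"
      unfolding a_def z_def using step(1)
      by (intro inner_column_le_inner_simplex p) (simp add: is_arg_min_linorder)
    moreover have za: "(norm z)\<^sup>2 \<le> z \<bullet> a"
      using min[OF axis_in_prob_simplex] by (simp add: z_def a_def matrix_vector_mult_basis)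
    \<comment> \<open>The choice of the index bounds \<open>w s \<bullet> (a - z)\<close> above by
      0; minimality of z bounds \<open>z \<bullet> (a - z)\<close> below by 0.\<close>
    ultimately have cross: "(w s - z) \<bullet> (a - z) \<le> 0"
      by (simp add: inner_diff_left inner_diff_right power2_norm_eq_inner)
    have "(norm a)\<^sup>2 \<le> 1"
      using col by (simp add: a_def power_le_one)
    moreover have "(norm (a - z))\<^sup>2 = (norm a)\<^sup>2 - 2 * (z \<bullet> a) + (norm z)\<^sup>2"
      by (simp add: power2_norm_eq_inner inner_diff_left inner_diff_right inner_commute)
    \<comment> \<open>By \<open>za\<close>, the expansion is at most 1 minus the square of
      \<open>norm z\<close>.\<close>
    ultimately have az: "(norm (a - z))\<^sup>2 \<le> 1"
      using za zero_le_power2[of "norm z"] by linarith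
    have "real (Suc s) *\<^sub>R w (Suc s) = real s *\<^sub>R w s + a"
      unfolding step(2) scaleR_add_right scaleR_scaleR by (simp add: field_simps)
    then have eq: "real (Suc s) *\<^sub>R (w (Suc s) - z) = real s *\<^sub>R (w s - z) + (a - z)"
      by (simp add: algebra_simps)
    have "(norm (real (Suc s) *\<^sub>R (w (Suc s) - z)))\<^sup>2
        = (norm (real s *\<^sub>R (w s - z)))\<^sup>2 + 2 * (real s * ((w s - z) \<bullet> (a - z))) + (norm (a - z))\<^sup>2"
      using dot_norm[of "real s *\<^sub>R (w s - z)" "a - z"]
      unfolding eq inner_scaleR_left by argo
    also have "\<dots> \<le> real s + 0 + 1"
      using Suc az mult_nonneg_nonpos[OF of_nat_0_le_iff cross, of s] by linarith
    finally show ?case by simp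
  qed
  have "real t * norm (w t - z) \<le> sqrt (real t)"
    using real_le_rsqrt[OF sq[of t]] by simp
  also have "\<dots> = real t * (1 / sqrt (real t))"
    using \<open>t \<ge> 1\<close> by (simp add: real_div_sqrt)
  finally show ?thesis
    unfolding z_def by (rule mult_left_le_imp_le) (use \<open>t \<ge> 1\<close> in simp)
qed

theorem theorem4:
  fixes A :: "real^'n^'d"
    and idx :: "nat \<Rightarrow> 'n"
    and \<alpha> :: "nat \<Rightarrow> real^'n"
    and w :: "nat \<Rightarrow> real^'d"
  assumes "\<forall>i. norm (column i A) = 1"
    and "\<exists>v. \<forall>i. (transpose A *v v) $ i > 0"
    and "normalized_perceptron A idx \<alpha> w"
  shows "(\<exists>!w_star. optimal_point A w_star) \<and>
    (\<forall>w_star. optimal_point A w_star \<longrightarrow>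
       margin_of A w_star = affine_margin_plus A \<and>
       affine_margin_plus A = (SUP v\<in>{v. norm v = 1}. margin_of A v) \<and>
       (\<forall>t\<ge>1.
          affine_margin_plus A - margin_of A (w t /\<^sub>R norm (w t))
            \<le> norm (w t /\<^sub>R norm (w t) - w_star) \<and>
          norm (w t /\<^sub>R norm (w t) - w_star)
            \<le> 4 / (affine_margin_plus A * sqrt (real t))))"
proof -
  from assms(2) obtain v where v: "\<And>i. v \<bullet> column i A > 0"
    by (auto simp: matrix_vector_mult_def transpose_def inner_vec_def column_def mult.commute)
  have col: "norm (column i A) \<le> 1" for i
    using assms(1) by simp
  obtain p where p: "p \<in> prob_simplex"
    and min: "\<And>q. q \<in> prob_simplex \<Longrightarrow> (norm (A *v p))\<^sup>2 \<le> (A *v p) \<bullet> (A *v q)"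
    using min_norm_simplex_image[of A] by blast
  define z where "z = A *v p"
  \<comment> \<open>The feasible v has a positive inner product with every column, so v \<bullet> z
    = 0 would make all weights of p vanish, although they sum to 1.\<close>
  have "z \<noteq> 0"
  proof
    assume "z = 0"
    then have "(\<Sum>i\<in>UNIV. p $ i * (v \<bullet> column i A)) = 0"
      by (simp add: z_def flip: inner_matrix_vector_mult)
    then have "\<forall>i. p $ i = 0"
      using p v by (subst (asm) sum_nonneg_eq_0_iff)
        (auto simp: prob_simplex_iff less_imp_le less_imp_neq[symmetric])
    then show False
      using p by (simp add: prob_simplex_iff)
  qed
  have le: "margin_of A u \<le> u \<bullet> z" for u
    using margin_of_le[OF p] by (simp add: z_def)
  have le_norm: "margin_of A u \<le> norm z" if "norm u = 1" for u
    using le[of u] norm_cauchy_schwarz[of u z] that by simp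
  \<comment> \<open>This is the variational inequality for z divided by
    \<open>norm z\<close>.\<close>
  have "norm z \<le> margin_of A (sgn z)"
  proof (rule margin_of_greatest)
    fix q :: "real^'n" assume "q \<in> prob_simplex"
    then show "norm z \<le> sgn z \<bullet> (A *v q)"
      using min[of q] \<open>z \<noteq> 0\<close> by (simp add: z_def sgn_div_norm power2_eq_square field_simps)
  qed
  with le_norm have opt: "margin_of A (sgn z) = norm z"
    by (simp add: \<open>z \<noteq> 0\<close> norm_sgn antisym)
  have opt_iff: "optimal_point A u \<longleftrightarrow> u = sgn z" for u
  proof
    assume "optimal_point A u"
    then have "norm u = 1" "norm z \<le> margin_of A u"
      using opt \<open>z \<noteq> 0\<close>
      by (auto simp: optimal_point_def is_arg_max_linorder norm_sgn dest!: spec[of _ "sgn z"])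
    then show "u = sgn z"
      using le[of u] \<open>z \<noteq> 0\<close> by (intro unit_vector_eq_sgn) auto
  next
    assume "u = sgn z"
    then show "optimal_point A u"
      using opt le_norm \<open>z \<noteq> 0\<close> by (simp add: optimal_point_def is_arg_max_linorder norm_sgn)
  qed
  have sup: "(SUP u\<in>{u. norm u = 1}. margin_of A u) = norm z"
    using opt le_norm \<open>z \<noteq> 0\<close>
    by (intro cSup_eq_maximum) (auto simp: norm_sgn image_iff intro!: exI[of _ "sgn z"])
  \<comment> \<open>The maximizer over the whole unit sphere already lies in the span of the
    columns, so restricting the supremum to that span leaves its value unchanged.\<close>
  have "sgn z \<in> span (columns A)"
    unfolding sgn_div_norm z_def by (intro span_scale matrix_vector_mult_in_columnspace)
  then have "affine_margin A = norm z"
    unfolding affine_margin_def using opt le_norm \<open>z \<noteq> 0\<close>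
    by (intro cSup_eq_maximum) (auto simp: norm_sgn image_iff intro!: exI[of _ "sgn z"])
  then have plus: "affine_margin_plus A = norm z"
    by (simp add: affine_margin_plus_def)
  have "norm (sgn (w t) - sgn z) \<le> 4 / (norm z * sqrt (real t))" if "t \<ge> 1" for t
  proof -
    have "norm (sgn (w t) - sgn z) \<le> 2 * norm (w t - z) / norm z"
      by (rule norm_diff_sgn_le) fact
    also have "\<dots> \<le> 2 * (1 / sqrt (real t)) / norm z"
      using normalized_perceptron_dist[OF col assms(3) p min that]
      by (intro divide_right_mono mult_left_mono) (auto simp: z_def)
    \<comment> \<open>The estimate so far has constant 2, which is relaxed to 4.\<close>
    also have "\<dots> \<le> 4 / (norm z * sqrt (real t))"
      by (simp add: divide_right_mono mult.commute)
    finally show ?thesis .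
  qed
  moreover have "norm z - margin_of A u \<le> norm (u - sgn z)" for u
    using margin_of_lipschitz[OF col, of "sgn z" u] by (simp add: opt)
  ultimately show ?thesis
    by (simp add: opt_iff opt plus sup flip: sgn_div_norm)
qed

end
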